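(* For a uniform space $M$, let $\mu(M)$ send the $n$-element linear order to the set $M^n$ equipped with the filter of topoic subsets, and send a map $k\mapsto i_k$ from $\{1,\dots,m\}$ to $\{1,\dots,n\}$ to the map $M^n\to M^m$, $(x_1,\dots,x_n)\mapsto(x_{i_1},\dots,x_{i_m})$. Then $\mu(M)$ is a well-defined functor $\mathrm{Ord}_{<\omega}^{op}\to\mathrm{Filt}$ which factors as $\mathrm{Ord}_{<\omega}^{op}\to\mathrm{FinSets}^{op}\to\mathrm{Filt}$, where the first functor is the forgetful one. Moreover, sending a uniformly continuous map $f:M\to M'$ to the natural transformation with components $f^n:M^n\to M'^n$ defines a fully faithful functor $$\mu:\mathrm{UniformSpaces}\to\mathrm{Func}(\mathrm{Ord}_{<\omega}^{op},\mathrm{Filt})$$ from the category of uniform spaces and uniformly continuous maps. In particular, this applies to metric spaces and uniformly continuous maps.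
   Context: $\mathrm{Filt}$ is the category of filters: an object is a set $S$ together with a collection of subsets of $S$, called big, containing $S$, closed under finite intersections and under passing to supersets (the empty set is allowed to be big). A morphism is a map of sets such that the preimage of every big subset is big. $\mathrm{Ord}_{<\omega}$ is the category of finite linear orders $\{1<\dots<n\}$, $0\le n<\omega$, and non-decreasing maps; $\mathrm{FinSets}$ is the category of finite sets and all maps. Topoic subsets: for a metric space $M$ and $n\ge1$, a subset $P\subseteq M^n$ is topoic if there is $\varepsilon>0$ such that $(x_1,\dots,x_n)\in P$ whenever $\mathrm{dist}(x_i,x_j)<\varepsilon$ for all $1\le i\le j\le n$. For a uniform space $M$, $P\subseteq M^n$ is topoic if there is an entourage $V\subseteq M\times M$ such that $(x_1,\dots,x_n)\in P$ whenever $(x_i,x_j)\in V$ for all $1\le i,j\le n$; for a metric space with its metric uniformity the two definitions agree. For $n=0$, the only topoic subset of the one-point set $M^0$ is $M^0$ itself. The big subsets of $M^n$ in $\mu(M)$ are the topoic subsets. *)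

theory Defs
  imports "HOL-Analysis.Analysis"
begin

section \<open>Categories, functors, natural transformations\<close>

text \<open>
  Hom-sets need not be disjoint, so composition is indexed by the three objects involved:
  \<open>Comp C X Y Z g f\<close> is the composite of \<open>f : X \<rightarrow> Y\<close> and \<open>g : Y \<rightarrow> Z\<close>.
\<close>

record ('o, 'm) cat =
  Ob   :: "'o set"
  Hom  :: "'o \<Rightarrow> 'o \<Rightarrow> 'm set"
  Idt  :: "'o \<Rightarrow> 'm"
  Comp :: "'o \<Rightarrow> 'o \<Rightarrow> 'o \<Rightarrow> 'm \<Rightarrow> 'm \<Rightarrow> 'm"

definition is_category :: "('o, 'm) cat \<Rightarrow> bool" where
  "is_category C \<longleftrightarrow>
     (\<forall>X\<in>Ob C. Idt C X \<in> Hom C X X) \<and>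
     (\<forall>X\<in>Ob C. \<forall>Y\<in>Ob C. \<forall>Z\<in>Ob C. \<forall>f\<in>Hom C X Y. \<forall>g\<in>Hom C Y Z.
        Comp C X Y Z g f \<in> Hom C X Z) \<and>
     (\<forall>X\<in>Ob C. \<forall>Y\<in>Ob C. \<forall>f\<in>Hom C X Y.
        Comp C X X Y f (Idt C X) = f \<and> Comp C X Y Y (Idt C Y) f = f) \<and>
     (\<forall>W\<in>Ob C. \<forall>X\<in>Ob C. \<forall>Y\<in>Ob C. \<forall>Z\<in>Ob C.
        \<forall>f\<in>Hom C W X. \<forall>g\<in>Hom C X Y. \<forall>h\<in>Hom C Y Z.
        Comp C W X Z (Comp C X Y Z h g) f = Comp C W Y Z h (Comp C W X Y g f))"

definition opp :: "('o, 'm) cat \<Rightarrow> ('o, 'm) cat" where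
  "opp C = \<lparr> Ob = Ob C, Hom = (\<lambda>X Y. Hom C Y X), Idt = Idt C,
             Comp = (\<lambda>X Y Z g f. Comp C Z Y X f g) \<rparr>"

text \<open>
  The data of a functor are required to be extensional (\<open>undefined\<close> outside the objects and
  Hom-sets of the source), so that equality in HOL is equality of functors; likewise for natural
  transformations.
\<close>

record ('o, 'm, 'p, 'q) fctr =
  on_ob  :: "'o \<Rightarrow> 'p"
  on_hom :: "'o \<Rightarrow> 'o \<Rightarrow> 'm \<Rightarrow> 'q"

definition is_functor :: "('o, 'm) cat \<Rightarrow> ('p, 'q) cat \<Rightarrow> ('o, 'm, 'p, 'q) fctr \<Rightarrow> bool" where
  "is_functor C D F \<longleftrightarrow>
     is_category C \<and> is_category D \<and>
     on_ob F \<in> Ob C \<rightarrow>\<^sub>E Ob D \<and>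
     on_hom F \<in> (\<Pi>\<^sub>E X\<in>Ob C. \<Pi>\<^sub>E Y\<in>Ob C. Hom C X Y \<rightarrow>\<^sub>E Hom D (on_ob F X) (on_ob F Y)) \<and>
     (\<forall>X\<in>Ob C. on_hom F X X (Idt C X) = Idt D (on_ob F X)) \<and>
     (\<forall>X\<in>Ob C. \<forall>Y\<in>Ob C. \<forall>Z\<in>Ob C. \<forall>f\<in>Hom C X Y. \<forall>g\<in>Hom C Y Z.
        on_hom F X Z (Comp C X Y Z g f) =
        Comp D (on_ob F X) (on_ob F Y) (on_ob F Z) (on_hom F Y Z g) (on_hom F X Y f))"

definition mk_functor ::
  "('o, 'm) cat \<Rightarrow> ('o \<Rightarrow> 'p) \<Rightarrow> ('o \<Rightarrow> 'o \<Rightarrow> 'm \<Rightarrow> 'q) \<Rightarrow> ('o, 'm, 'p, 'q) fctr" where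
  "mk_functor C F0 F1 =
     \<lparr> on_ob = (\<lambda>X\<in>Ob C. F0 X),
       on_hom = (\<lambda>X\<in>Ob C. \<lambda>Y\<in>Ob C. \<lambda>f\<in>Hom C X Y. F1 X Y f) \<rparr>"

definition comp_functor ::
  "('o, 'm) cat \<Rightarrow> ('p, 'q, 'r, 's) fctr \<Rightarrow> ('o, 'm, 'p, 'q) fctr \<Rightarrow> ('o, 'm, 'r, 's) fctr" where
  "comp_functor C G F =
     mk_functor C (\<lambda>X. on_ob G (on_ob F X))
       (\<lambda>X Y f. on_hom G (on_ob F X) (on_ob F Y) (on_hom F X Y f))"

definition opp_functor :: "('o, 'm) cat \<Rightarrow> ('o, 'm, 'p, 'q) fctr \<Rightarrow> ('o, 'm, 'p, 'q) fctr" where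
  "opp_functor C F = mk_functor (opp C) (on_ob F) (\<lambda>X Y. on_hom F Y X)"

definition nat_trans ::
  "('o, 'm) cat \<Rightarrow> ('p, 'q) cat \<Rightarrow> ('o, 'm, 'p, 'q) fctr \<Rightarrow> ('o, 'm, 'p, 'q) fctr \<Rightarrow> ('o \<Rightarrow> 'q) set" where
  "nat_trans C D F G =
     {\<eta> \<in> (\<Pi>\<^sub>E X\<in>Ob C. Hom D (on_ob F X) (on_ob G X)).
        \<forall>X\<in>Ob C. \<forall>Y\<in>Ob C. \<forall>f\<in>Hom C X Y.
          Comp D (on_ob F X) (on_ob F Y) (on_ob G Y) (\<eta> Y) (on_hom F X Y f) =
          Comp D (on_ob F X) (on_ob G X) (on_ob G Y) (on_hom G X Y f) (\<eta> X)}"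

definition FunctorCat ::
  "('o, 'm) cat \<Rightarrow> ('p, 'q) cat \<Rightarrow> (('o, 'm, 'p, 'q) fctr, 'o \<Rightarrow> 'q) cat" where
  "FunctorCat C D =
     \<lparr> Ob = {F. is_functor C D F},
       Hom = nat_trans C D,
       Idt = (\<lambda>F. \<lambda>X\<in>Ob C. Idt D (on_ob F X)),
       Comp = (\<lambda>F G H \<beta> \<alpha>. \<lambda>X\<in>Ob C. Comp D (on_ob F X) (on_ob G X) (on_ob H X) (\<beta> X) (\<alpha> X)) \<rparr>"

definition fully_faithful :: "('o, 'm) cat \<Rightarrow> ('p, 'q) cat \<Rightarrow> ('o, 'm, 'p, 'q) fctr \<Rightarrow> bool" where
  "fully_faithful C D F \<longleftrightarrow>
     (\<forall>X\<in>Ob C. \<forall>Y\<in>Ob C. bij_betw (on_hom F X Y) (Hom C X Y) (Hom D (on_ob F X) (on_ob F Y)))"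


section \<open>Filters, finite linear orders, finite sets\<close>

record 'a filt =
  points :: "'a set"
  big    :: "'a set set"

definition is_filt :: "'a filt \<Rightarrow> bool" where
  "is_filt S \<longleftrightarrow>
     big S \<subseteq> Pow (points S) \<and> points S \<in> big S \<and>
     (\<forall>A\<in>big S. \<forall>B\<in>big S. A \<inter> B \<in> big S) \<and>
     (\<forall>A\<in>big S. \<forall>B. A \<subseteq> B \<and> B \<subseteq> points S \<longrightarrow> B \<in> big S)"

definition Filt :: "('a filt, 'a \<Rightarrow> 'a) cat" where
  "Filt =
     \<lparr> Ob = {S. is_filt S},
       Hom = (\<lambda>S T. {f \<in> points S \<rightarrow>\<^sub>E points T. \<forall>B\<in>big T. {x\<in>points S. f x \<in> B} \<in> big S}),
       Idt = (\<lambda>S. \<lambda>x\<in>points S. x),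
       Comp = (\<lambda>S T U g f. compose (points S) g f) \<rparr>"

text \<open>The object \<open>n\<close> of \<open>Ord_fin\<close> is the linear order \<open>{1..n}\<close>.\<close>

definition Ord_fin :: "(nat, nat \<Rightarrow> nat) cat" where
  "Ord_fin =
     \<lparr> Ob = UNIV,
       Hom = (\<lambda>m n. {\<phi> \<in> {1..m} \<rightarrow>\<^sub>E {1..n}. mono_on {1..m} \<phi>}),
       Idt = (\<lambda>n. \<lambda>k\<in>{1..n}. k),
       Comp = (\<lambda>l m n \<psi> \<phi>. compose {1..l} \<psi> \<phi>) \<rparr>"

text \<open>Finite sets are taken inside \<open>nat\<close>, which contains a copy of each of them.\<close>

definition FinSets :: "(nat set, nat \<Rightarrow> nat) cat" where
  "FinSets =
     \<lparr> Ob = {A. finite A},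
       Hom = (\<lambda>A B. A \<rightarrow>\<^sub>E B),
       Idt = (\<lambda>A. \<lambda>k\<in>A. k),
       Comp = (\<lambda>A B C \<psi> \<phi>. compose A \<psi> \<phi>) \<rparr>"

definition Forget :: "(nat, nat \<Rightarrow> nat, nat set, nat \<Rightarrow> nat) fctr" where
  "Forget = mk_functor Ord_fin (\<lambda>n. {1..n}) (\<lambda>m n \<phi>. \<phi>)"


section \<open>Uniform spaces and metric spaces\<close>

text \<open>
  Uniform spaces with an explicit carrier (possibly empty, not necessarily Hausdorff). The type
  \<open>'a\<close> serves as a universe: since it is arbitrary, any two uniform spaces lie in a common one.
\<close>

record 'a uspace =
  upoints    :: "'a set"
  entourages :: "('a \<times> 'a) set set"

definition is_uspace :: "'a uspace \<Rightarrow> bool" where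
  "is_uspace M \<longleftrightarrow>
     is_filt \<lparr> points = upoints M \<times> upoints M, big = entourages M \<rparr> \<and>
     (\<forall>V\<in>entourages M. Id_on (upoints M) \<subseteq> V) \<and>
     (\<forall>V\<in>entourages M. V\<inverse> \<in> entourages M) \<and>
     (\<forall>V\<in>entourages M. \<exists>W\<in>entourages M. W O W \<subseteq> V)"

definition UniformSpaces :: "('a uspace, 'a \<Rightarrow> 'a) cat" where
  "UniformSpaces =
     \<lparr> Ob = {M. is_uspace M},
       Hom = (\<lambda>M N. {f \<in> upoints M \<rightarrow>\<^sub>E upoints N.
          \<forall>V\<in>entourages N. \<exists>U\<in>entourages M. \<forall>(x, y)\<in>U. (f x, f y) \<in> V}),
       Idt = (\<lambda>M. \<lambda>x\<in>upoints M. x),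
       Comp = (\<lambda>M N P g f. compose (upoints M) g f) \<rparr>"

definition MetricSpaces :: "('a metric, 'a \<Rightarrow> 'a) cat" where
  "MetricSpaces =
     \<lparr> Ob = UNIV,
       Hom = (\<lambda>m m'. {f \<in> extensional (mspace m). uniformly_continuous_map m m' f}),
       Idt = (\<lambda>m. \<lambda>x\<in>mspace m. x),
       Comp = (\<lambda>m m' m'' g f. compose (mspace m) g f) \<rparr>"

definition metric_uspace :: "'a metric \<Rightarrow> 'a uspace" where
  "metric_uspace m =
     \<lparr> upoints = mspace m,
       entourages = {V. V \<subseteq> mspace m \<times> mspace m \<and>
         (\<exists>\<epsilon>>0. \<forall>x\<in>mspace m. \<forall>y\<in>mspace m. mdist m x y < \<epsilon> \<longrightarrow> (x, y) \<in> V)} \<rparr>"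


section \<open>Topoic subsets and the functor \<open>\<mu>\<close>\<close>

definition tuples :: "'a set \<Rightarrow> nat \<Rightarrow> (nat \<Rightarrow> 'a) set" where
  "tuples S n = {1..n} \<rightarrow>\<^sub>E S"

definition topoic :: "'a uspace \<Rightarrow> nat \<Rightarrow> (nat \<Rightarrow> 'a) set set" where
  "topoic M n =
     (if n = 0 then {tuples (upoints M) 0}
      else {P. P \<subseteq> tuples (upoints M) n \<and>
        (\<exists>V\<in>entourages M. \<forall>x\<in>tuples (upoints M) n.
           (\<forall>i\<in>{1..n}. \<forall>j\<in>{1..n}. (x i, x j) \<in> V) \<longrightarrow> x \<in> P)})"

definition metric_topoic :: "'a metric \<Rightarrow> nat \<Rightarrow> (nat \<Rightarrow> 'a) set set" where
  "metric_topoic m n =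
     (if n = 0 then {tuples (mspace m) 0}
      else {P. P \<subseteq> tuples (mspace m) n \<and>
        (\<exists>\<epsilon>>0. \<forall>x\<in>tuples (mspace m) n.
           (\<forall>i\<in>{1..n}. \<forall>j\<in>{i..n}. mdist m (x i) (x j) < \<epsilon>) \<longrightarrow> x \<in> P)})"

text \<open>
  The assignment \<open>n \<mapsto> S\<^sup>n\<close>, with big subsets of \<open>S\<^sup>n\<close> given by \<open>T n\<close>. A morphism \<open>n \<rightarrow> m\<close> of the
  opposite category is a map \<open>\<phi>\<close> from \<open>{1..m}\<close> to \<open>{1..n}\<close>.
\<close>

definition powers_functor ::
  "'a set \<Rightarrow> (nat \<Rightarrow> (nat \<Rightarrow> 'a) set set) \<Rightarrow>
   (nat, nat \<Rightarrow> nat, (nat \<Rightarrow> 'a) filt, (nat \<Rightarrow> 'a) \<Rightarrow> (nat \<Rightarrow> 'a)) fctr" where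
  "powers_functor S T =
     mk_functor (opp Ord_fin)
       (\<lambda>n. \<lparr> points = tuples S n, big = T n \<rparr>)
       (\<lambda>n m \<phi>. \<lambda>x\<in>tuples S n. \<lambda>k\<in>{1..m}. x (\<phi> k))"

definition mu_ob ::
  "'a uspace \<Rightarrow> (nat, nat \<Rightarrow> nat, (nat \<Rightarrow> 'a) filt, (nat \<Rightarrow> 'a) \<Rightarrow> (nat \<Rightarrow> 'a)) fctr" where
  "mu_ob M = powers_functor (upoints M) (topoic M)"

definition metric_mu_ob ::
  "'a metric \<Rightarrow> (nat, nat \<Rightarrow> nat, (nat \<Rightarrow> 'a) filt, (nat \<Rightarrow> 'a) \<Rightarrow> (nat \<Rightarrow> 'a)) fctr" where
  "metric_mu_ob m = powers_functor (mspace m) (metric_topoic m)"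

definition powers_map :: "'a set \<Rightarrow> ('a \<Rightarrow> 'a) \<Rightarrow> nat \<Rightarrow> (nat \<Rightarrow> 'a) \<Rightarrow> (nat \<Rightarrow> 'a)" where
  "powers_map S f = (\<lambda>n\<in>Ob (opp Ord_fin). \<lambda>x\<in>tuples S n. \<lambda>k\<in>{1..n}. f (x k))"

definition mu ::
  "('a uspace, 'a \<Rightarrow> 'a,
    (nat, nat \<Rightarrow> nat, (nat \<Rightarrow> 'a) filt, (nat \<Rightarrow> 'a) \<Rightarrow> (nat \<Rightarrow> 'a)) fctr,
    nat \<Rightarrow> (nat \<Rightarrow> 'a) \<Rightarrow> (nat \<Rightarrow> 'a)) fctr" where
  "mu = mk_functor UniformSpaces mu_ob (\<lambda>M N f. powers_map (upoints M) f)"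

definition metric_mu ::
  "('a metric, 'a \<Rightarrow> 'a,
    (nat, nat \<Rightarrow> nat, (nat \<Rightarrow> 'a) filt, (nat \<Rightarrow> 'a) \<Rightarrow> (nat \<Rightarrow> 'a)) fctr,
    nat \<Rightarrow> (nat \<Rightarrow> 'a) \<Rightarrow> (nat \<Rightarrow> 'a)) fctr" where
  "metric_mu = mk_functor MetricSpaces metric_mu_ob (\<lambda>m m' f. powers_map (mspace m) f)"

end

theory Submission
  imports Defs
begin

text \<open>
  The definition of a topoic subset refers only to the set of coordinates of a tuple, not to their
  order, and so makes sense for tuples indexed by any set \<open>A\<close> (\<open>power_filt\<close>). Reindexing along an
  arbitrary map \<open>B \<rightarrow> A\<close> only forgets or repeats coordinates, so a tuple whose coordinates are
  pairwise \<open>V\<close>-close stays such, and the same entourage \<open>V\<close> witnesses that preimages of big sets are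
  big. This gives a functor on \<open>opp FinSets\<close>, and \<open>mu_ob M\<close> is its composite with the forgetful
  functor (\<open>mu_ob_factors\<close>). That \<open>mu_ob M\<close> is a functor is then a consequence.

  Full faithfulness rests on the powers \<open>1\<close> and \<open>2\<close> of \<open>M\<close>. The first component of a natural
  transformation \<open>\<eta>\<close> is a map \<open>f\<close> on points. Each coordinate \<open>M\<^sup>n \<rightarrow> M\<close> is induced by the map
  \<open>{1} \<rightarrow> {1..n}\<close> choosing that coordinate, which is monotone, so naturality forces \<open>\<eta>\<close> to act by \<open>f\<close>
  in each coordinate (\<open>nat_trans_mu_ob_is_powers_map\<close>). An entourage of \<open>N\<close> is a topoic subset of
  \<open>N\<^sup>2\<close>, and for its preimage to be topoic in \<open>M\<^sup>2\<close> is exactly uniform continuity of \<open>f\<close>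
  (\<open>uniformly_continuous_if_square_in_Hom\<close>).

  For metric spaces both the topoic subsets and the morphisms agree with those of the metric
  uniformity. Hence the metric version of \<open>\<mu>\<close> is the composite of \<open>\<mu>\<close> with the fully faithful
  inclusion of metric spaces into uniform spaces (\<open>metric_mu_eq\<close>).
\<close>

section \<open>Generalities on categories and functors\<close>

lemma compose_in_PiE:
  "\<lbrakk>f \<in> A \<rightarrow>\<^sub>E B; g \<in> B \<rightarrow>\<^sub>E C\<rbrakk> \<Longrightarrow> compose A g f \<in> A \<rightarrow>\<^sub>E C"
  using funcset_compose[of f A B g C] by (simp add: PiE_def)

text \<open>
  The common reason why the four categories of structured sets below are categories: the unit and
  associativity laws hold for extensional functions, so only closure under identities and
  composition depends on the structure.
\<close>

lemma is_category_concrete: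
  fixes C :: "('o, 'a \<Rightarrow> 'a) cat" and c :: "'o \<Rightarrow> 'a set"
  assumes Id: "\<And>X. Idt C X = (\<lambda>x\<in>c X. x)"
    and Cm: "\<And>X Y Z g f. Comp C X Y Z g f = compose (c X) g f"
    and Hom: "\<And>X Y f. \<lbrakk>X \<in> Ob C; Y \<in> Ob C; f \<in> Hom C X Y\<rbrakk> \<Longrightarrow> f \<in> c X \<rightarrow>\<^sub>E c Y"
    and id: "\<And>X. X \<in> Ob C \<Longrightarrow> (\<lambda>x\<in>c X. x) \<in> Hom C X X"
    and comp: "\<And>X Y Z f g. \<lbrakk>X \<in> Ob C; Y \<in> Ob C; Z \<in> Ob C; f \<in> Hom C X Y; g \<in> Hom C Y Z\<rbrakk>
                 \<Longrightarrow> compose (c X) g f \<in> Hom C X Z"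
  shows "is_category C"
proof -
  have fm: "f \<in> c X \<rightarrow> c Y" and fe: "f \<in> extensional (c X)"
    if "X \<in> Ob C" "Y \<in> Ob C" "f \<in> Hom C X Y" for X Y f
    using Hom[OF that] by (auto simp: PiE_def)
  show ?thesis
    unfolding is_category_def Id Cm
  proof (intro conjI ballI)
    fix X Y f assume *: "X \<in> Ob C" "Y \<in> Ob C" "f \<in> Hom C X Y"
    show "compose (c X) f (\<lambda>x\<in>c X. x) = f" "compose (c X) (\<lambda>x\<in>c Y. x) f = f"
      using fm[OF *] fe[OF *] by (auto intro: compose_Id Id_compose)
  next
    fix W X Y Z f g h
    assume "W \<in> Ob C" "X \<in> Ob C" "Y \<in> Ob C" "Z \<in> Ob C"
      "f \<in> Hom C W X" "g \<in> Hom C X Y" "h \<in> Hom C Y Z"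
    then show "compose (c W) (compose (c X) h g) f = compose (c W) h (compose (c W) g f)"
      using fm[of W X f] by (auto simp: compose_def restrict_def fun_eq_iff Pi_iff)
  qed (simp_all add: id comp)
qed

lemma is_categoryD:
  assumes "is_category C"
  shows "X \<in> Ob C \<Longrightarrow> Idt C X \<in> Hom C X X"
    and "\<lbrakk>X \<in> Ob C; Y \<in> Ob C; Z \<in> Ob C; f \<in> Hom C X Y; g \<in> Hom C Y Z\<rbrakk> \<Longrightarrow> Comp C X Y Z g f \<in> Hom C X Z"
    and "\<lbrakk>X \<in> Ob C; Y \<in> Ob C; f \<in> Hom C X Y\<rbrakk> \<Longrightarrow> Comp C X X Y f (Idt C X) = f"
    and "\<lbrakk>X \<in> Ob C; Y \<in> Ob C; f \<in> Hom C X Y\<rbrakk> \<Longrightarrow> Comp C X Y Y (Idt C Y) f = f"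
    and "\<lbrakk>W \<in> Ob C; X \<in> Ob C; Y \<in> Ob C; Z \<in> Ob C;
          f \<in> Hom C W X; g \<in> Hom C X Y; h \<in> Hom C Y Z\<rbrakk>
         \<Longrightarrow> Comp C W X Z (Comp C X Y Z h g) f = Comp C W Y Z h (Comp C W X Y g f)"
  using assms by (simp_all add: is_category_def)

lemma is_category_opp:
  assumes "is_category C" shows "is_category (opp C)"
  using assms unfolding is_category_def opp_def by simp

lemma mk_functor_apply:
  "X \<in> Ob C \<Longrightarrow> on_ob (mk_functor C F0 F1) X = F0 X"
  "\<lbrakk>X \<in> Ob C; Y \<in> Ob C; f \<in> Hom C X Y\<rbrakk> \<Longrightarrow> on_hom (mk_functor C F0 F1) X Y f = F1 X Y f"
  by (simp_all add: mk_functor_def)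

lemma mk_functor_cong:
  assumes "\<And>X. X \<in> Ob C \<Longrightarrow> F0 X = G0 X"
    and "\<And>X Y f. \<lbrakk>X \<in> Ob C; Y \<in> Ob C; f \<in> Hom C X Y\<rbrakk> \<Longrightarrow> F1 X Y f = G1 X Y f"
  shows "mk_functor C F0 F1 = mk_functor C G0 G1"
  using assms by (auto simp: mk_functor_def fun_eq_iff restrict_def)

lemma is_functor_mk_functor:
  assumes cats: "is_category C" "is_category D"
    and ob: "\<And>X. X \<in> Ob C \<Longrightarrow> F0 X \<in> Ob D"
    and hom: "\<And>X Y f. \<lbrakk>X \<in> Ob C; Y \<in> Ob C; f \<in> Hom C X Y\<rbrakk> \<Longrightarrow> F1 X Y f \<in> Hom D (F0 X) (F0 Y)"
    and id: "\<And>X. X \<in> Ob C \<Longrightarrow> F1 X X (Idt C X) = Idt D (F0 X)"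
    and comp: "\<And>X Y Z f g. \<lbrakk>X \<in> Ob C; Y \<in> Ob C; Z \<in> Ob C; f \<in> Hom C X Y; g \<in> Hom C Y Z\<rbrakk>
        \<Longrightarrow> F1 X Z (Comp C X Y Z g f) = Comp D (F0 X) (F0 Y) (F0 Z) (F1 Y Z g) (F1 X Y f)"
  shows "is_functor C D (mk_functor C F0 F1)"
proof -
  note C = is_categoryD(1,2)[OF cats(1)]
  have "on_ob (mk_functor C F0 F1) \<in> Ob C \<rightarrow>\<^sub>E Ob D"
    using ob by (auto simp: mk_functor_def)
  moreover have "on_hom (mk_functor C F0 F1) \<in> (\<Pi>\<^sub>E X\<in>Ob C. \<Pi>\<^sub>E Y\<in>Ob C. Hom C X Y \<rightarrow>\<^sub>E
      Hom D (on_ob (mk_functor C F0 F1) X) (on_ob (mk_functor C F0 F1) Y))"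
    using hom by (auto simp: mk_functor_def)
  ultimately show ?thesis
    unfolding is_functor_def using cats id comp C
    by (auto simp: mk_functor_apply)
qed

lemma is_functorD:
  assumes "is_functor C D F"
  shows "is_category C" "is_category D"
    and "X \<in> Ob C \<Longrightarrow> on_ob F X \<in> Ob D"
    and "\<lbrakk>X \<in> Ob C; Y \<in> Ob C; f \<in> Hom C X Y\<rbrakk> \<Longrightarrow> on_hom F X Y f \<in> Hom D (on_ob F X) (on_ob F Y)"
    and "X \<in> Ob C \<Longrightarrow> on_hom F X X (Idt C X) = Idt D (on_ob F X)"
    and "\<lbrakk>X \<in> Ob C; Y \<in> Ob C; Z \<in> Ob C; f \<in> Hom C X Y; g \<in> Hom C Y Z\<rbrakk>
        \<Longrightarrow> on_hom F X Z (Comp C X Y Z g f) =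
            Comp D (on_ob F X) (on_ob F Y) (on_ob F Z) (on_hom F Y Z g) (on_hom F X Y f)"
proof -
  have hom: "on_hom F \<in> (\<Pi>\<^sub>E X\<in>Ob C. \<Pi>\<^sub>E Y\<in>Ob C. Hom C X Y \<rightarrow>\<^sub>E Hom D (on_ob F X) (on_ob F Y))"
    using assms by (simp add: is_functor_def)
  show "on_hom F X Y f \<in> Hom D (on_ob F X) (on_ob F Y)"
    if "X \<in> Ob C" "Y \<in> Ob C" "f \<in> Hom C X Y"
    using PiE_mem[OF PiE_mem[OF PiE_mem[OF hom that(1)] that(2)] that(3)] .
qed (use assms in \<open>auto simp: is_functor_def\<close>)

lemma is_functor_opp_functor:
  assumes F: "is_functor C D F"
  shows "is_functor (opp C) (opp D) (opp_functor C F)"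
  unfolding opp_functor_def
proof (rule is_functor_mk_functor)
  show "is_category (opp C)" "is_category (opp D)"
    using is_functorD(1,2)[OF F] by (auto intro: is_category_opp)
qed (auto simp: opp_def is_functorD(3-6)[OF F])

lemma is_functor_comp_functor:
  assumes F: "is_functor C D F" and G: "is_functor D E G"
  shows "is_functor C E (comp_functor C G F)"
  unfolding comp_functor_def
proof (rule is_functor_mk_functor)
  show "is_category C" "is_category E"
    using is_functorD(1,2)[OF F] is_functorD(1,2)[OF G] by auto
qed (auto simp: is_functorD(3-6)[OF F] is_functorD(3-6)[OF G])

lemma fully_faithful_comp_functor:
  assumes F: "is_functor C D F" and ffF: "fully_faithful C D F" and ffG: "fully_faithful D E G"
  shows "fully_faithful C E (comp_functor C G F)"
  unfolding fully_faithful_def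
proof (intro ballI)
  fix X Y assume X: "X \<in> Ob C" and Y: "Y \<in> Ob C"
  have "bij_betw (on_hom F X Y) (Hom C X Y) (Hom D (on_ob F X) (on_ob F Y))"
    "bij_betw (on_hom G (on_ob F X) (on_ob F Y)) (Hom D (on_ob F X) (on_ob F Y))
       (Hom E (on_ob G (on_ob F X)) (on_ob G (on_ob F Y)))"
    using ffF ffG X Y is_functorD(3)[OF F] by (auto simp: fully_faithful_def)
  then have "bij_betw (on_hom G (on_ob F X) (on_ob F Y) \<circ> on_hom F X Y) (Hom C X Y)
      (Hom E (on_ob G (on_ob F X)) (on_ob G (on_ob F Y)))"
    by (rule bij_betw_trans)
  then show "bij_betw (on_hom (comp_functor C G F) X Y) (Hom C X Y)
      (Hom E (on_ob (comp_functor C G F) X) (on_ob (comp_functor C G F) Y))"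
    using X Y by (subst bij_betw_cong[where g = "on_hom G (on_ob F X) (on_ob F Y) \<circ> on_hom F X Y"])
      (auto simp: comp_functor_def mk_functor_apply)
qed

lemma nat_transD:
  assumes "\<eta> \<in> nat_trans C D F G"
  shows "X \<in> Ob C \<Longrightarrow> \<eta> X \<in> Hom D (on_ob F X) (on_ob G X)"
    and "\<lbrakk>X \<in> Ob C; Y \<in> Ob C; f \<in> Hom C X Y\<rbrakk> \<Longrightarrow>
          Comp D (on_ob F X) (on_ob F Y) (on_ob G Y) (\<eta> Y) (on_hom F X Y f) =
          Comp D (on_ob F X) (on_ob G X) (on_ob G Y) (on_hom G X Y f) (\<eta> X)"
    and "\<eta> \<in> extensional (Ob C)"
  using assms by (auto simp: nat_trans_def PiE_iff)

text \<open>
  The laws hold componentwise. Naturality of a composite comes from pasting two commutative squares;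
  extensionality of natural transformations makes the unit laws genuine equalities.
\<close>

lemma is_category_FunctorCat:
  assumes D: "is_category D"
  shows "is_category (FunctorCat C D)"
proof -
  note D1 = is_categoryD(1)[OF D] and D2 = is_categoryD(2)[OF D]
    and D3 = is_categoryD(3,4)[OF D] and D4 = is_categoryD(5)[OF D]
  show ?thesis
    unfolding is_category_def
  proof (intro conjI ballI)
    fix F assume "F \<in> Ob (FunctorCat C D)"
    then have F: "is_functor C D F" by (simp add: FunctorCat_def)
    show "Idt (FunctorCat C D) F \<in> Hom (FunctorCat C D) F F"
      by (auto simp: FunctorCat_def nat_trans_def D1 D3 is_functorD(3)[OF F]
           D3[OF is_functorD(3)[OF F] is_functorD(3)[OF F] is_functorD(4)[OF F]])
  next
    fix F G H \<alpha> \<beta>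
    assume "F \<in> Ob (FunctorCat C D)" "G \<in> Ob (FunctorCat C D)" "H \<in> Ob (FunctorCat C D)"
      "\<alpha> \<in> Hom (FunctorCat C D) F G" "\<beta> \<in> Hom (FunctorCat C D) G H"
    then have F: "is_functor C D F" and G: "is_functor C D G" and H: "is_functor C D H"
      and \<alpha>: "\<alpha> \<in> nat_trans C D F G" and \<beta>: "\<beta> \<in> nat_trans C D G H"
      by (auto simp: FunctorCat_def)
    note ob = is_functorD(3)[OF F] is_functorD(3)[OF G] is_functorD(3)[OF H]
    note mor = is_functorD(4)[OF F] is_functorD(4)[OF G] is_functorD(4)[OF H]
      nat_transD(1)[OF \<alpha>] nat_transD(1)[OF \<beta>]
    let ?\<gamma> = "\<lambda>X. Comp D (on_ob F X) (on_ob G X) (on_ob H X) (\<beta> X) (\<alpha> X)"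
    have "Comp D (on_ob F X) (on_ob F Y) (on_ob H Y) (?\<gamma> Y) (on_hom F X Y f) =
          Comp D (on_ob F X) (on_ob H X) (on_ob H Y) (on_hom H X Y f) (?\<gamma> X)"
      if X: "X \<in> Ob C" and Y: "Y \<in> Ob C" and f: "f \<in> Hom C X Y" for X Y f
    proof -
      have "Comp D (on_ob F X) (on_ob F Y) (on_ob H Y) (?\<gamma> Y) (on_hom F X Y f) =
            Comp D (on_ob F X) (on_ob G Y) (on_ob H Y) (\<beta> Y)
              (Comp D (on_ob F X) (on_ob F Y) (on_ob G Y) (\<alpha> Y) (on_hom F X Y f))"
        using X Y f by (intro D4 ob mor)
      also have "\<dots> = Comp D (on_ob F X) (on_ob G Y) (on_ob H Y) (\<beta> Y)
              (Comp D (on_ob F X) (on_ob G X) (on_ob G Y) (on_hom G X Y f) (\<alpha> X))"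
        using nat_transD(2)[OF \<alpha> X Y f] by simp
      also have "\<dots> = Comp D (on_ob F X) (on_ob G X) (on_ob H Y)
              (Comp D (on_ob G X) (on_ob G Y) (on_ob H Y) (\<beta> Y) (on_hom G X Y f)) (\<alpha> X)"
        using X Y f by (intro D4[symmetric] ob mor)
      also have "\<dots> = Comp D (on_ob F X) (on_ob G X) (on_ob H Y)
              (Comp D (on_ob G X) (on_ob H X) (on_ob H Y) (on_hom H X Y f) (\<beta> X)) (\<alpha> X)"
        using nat_transD(2)[OF \<beta> X Y f] by simp
      also have "\<dots> = Comp D (on_ob F X) (on_ob H X) (on_ob H Y) (on_hom H X Y f) (?\<gamma> X)"
        using X Y f by (intro D4 ob mor)
      finally show ?thesis .
    qed
    then show "Comp (FunctorCat C D) F G H \<beta> \<alpha> \<in> Hom (FunctorCat C D) F H"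
      by (auto simp: FunctorCat_def nat_trans_def intro!: D2 ob mor)
  next
    fix F G \<alpha>
    assume "F \<in> Ob (FunctorCat C D)" "G \<in> Ob (FunctorCat C D)" "\<alpha> \<in> Hom (FunctorCat C D) F G"
    then have F: "is_functor C D F" and G: "is_functor C D G" and \<alpha>: "\<alpha> \<in> nat_trans C D F G"
      by (auto simp: FunctorCat_def)
    show "Comp (FunctorCat C D) F F G \<alpha> (Idt (FunctorCat C D) F) = \<alpha>"
      "Comp (FunctorCat C D) F G G (Idt (FunctorCat C D) G) \<alpha> = \<alpha>"
      by (auto simp: FunctorCat_def D3[OF is_functorD(3)[OF F] is_functorD(3)[OF G] nat_transD(1)[OF \<alpha>]]
          intro!: extensionalityI[OF _ nat_transD(3)[OF \<alpha>]])
  next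
    fix F G H K \<alpha> \<beta> \<gamma>
    assume "F \<in> Ob (FunctorCat C D)" "G \<in> Ob (FunctorCat C D)"
      "H \<in> Ob (FunctorCat C D)" "K \<in> Ob (FunctorCat C D)"
      "\<alpha> \<in> Hom (FunctorCat C D) F G" "\<beta> \<in> Hom (FunctorCat C D) G H"
      "\<gamma> \<in> Hom (FunctorCat C D) H K"
    then have F: "is_functor C D F" "is_functor C D G" "is_functor C D H" "is_functor C D K"
      and \<alpha>: "\<alpha> \<in> nat_trans C D F G" and \<beta>: "\<beta> \<in> nat_trans C D G H"
      and \<gamma>: "\<gamma> \<in> nat_trans C D H K"
      by (auto simp: FunctorCat_def)
    show "Comp (FunctorCat C D) F G K (Comp (FunctorCat C D) G H K \<gamma> \<beta>) \<alpha> =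
          Comp (FunctorCat C D) F H K \<gamma> (Comp (FunctorCat C D) F G H \<beta> \<alpha>)"
      by (auto simp: FunctorCat_def fun_eq_iff restrict_def
          intro!: D4 is_functorD(3)[OF F(1)] is_functorD(3)[OF F(2)] is_functorD(3)[OF F(3)]
            is_functorD(3)[OF F(4)] nat_transD(1)[OF \<alpha>] nat_transD(1)[OF \<beta>] nat_transD(1)[OF \<gamma>])
  qed
qed


section \<open>The categories of the theorem\<close>

lemma is_category_Filt: "is_category Filt"
proof (rule is_category_concrete[where c = points])
  fix S T U f g
  assume f: "f \<in> Hom Filt S T" and g: "g \<in> Hom Filt T U"
  have "{x \<in> points S. compose (points S) g f x \<in> B} \<in> big S" if "B \<in> big U" for B
  proof -
    have "{x \<in> points S. f x \<in> {y \<in> points T. g y \<in> B}} \<in> big S"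
    proof -
      have "{y \<in> points T. g y \<in> B} \<in> big T"
        using g that by (simp add: Filt_def)
      moreover have "\<forall>B\<in>big T. {x \<in> points S. f x \<in> B} \<in> big S"
        using f by (simp add: Filt_def)
      ultimately show ?thesis by blast
    qed
    moreover have "{x \<in> points S. f x \<in> {y \<in> points T. g y \<in> B}} =
        {x \<in> points S. compose (points S) g f x \<in> B}"
      using f by (auto simp: Filt_def compose_eq)
    ultimately show ?thesis by simp
  qed
  then show "compose (points S) g f \<in> Hom Filt S U"
    using f g by (simp add: Filt_def compose_in_PiE[of f _ "points T"])
next
  fix S :: "'a filt" assume "S \<in> Ob Filt"
  then have "is_filt S" by (simp add: Filt_def)
  moreover have "{x \<in> points S. (if x \<in> points S then x else undefined) \<in> B} = points S \<inter> B" for B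
    by auto
  ultimately show "(\<lambda>x\<in>points S. x) \<in> Hom Filt S S"
    by (auto simp: Filt_def is_filt_def restrict_def PiE_iff extensional_def)
qed (auto simp: Filt_def)

lemma is_category_Ord_fin: "is_category Ord_fin"
proof (rule is_category_concrete[where c = "\<lambda>n. {1..n}"])
  fix l m n \<phi> \<psi>
  assume "\<phi> \<in> Hom Ord_fin l m" "\<psi> \<in> Hom Ord_fin m n"
  then have \<phi>: "\<phi> \<in> {1..l} \<rightarrow>\<^sub>E {1..m}" "mono_on {1..l} \<phi>"
    and \<psi>: "\<psi> \<in> {1..m} \<rightarrow>\<^sub>E {1..n}" "mono_on {1..m} \<psi>"
    by (simp_all add: Ord_fin_def)
  have "mono_on {1..l} (compose {1..l} \<psi> \<phi>)"
  proof (rule mono_onI)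
    fix i j assume ij: "i \<in> {1..l}" "j \<in> {1..l}" "i \<le> j"
    then have "\<phi> i \<in> {1..m}" "\<phi> j \<in> {1..m}" "\<phi> i \<le> \<phi> j"
      using PiE_mem[OF \<phi>(1)] mono_onD[OF \<phi>(2)] by blast+
    then show "compose {1..l} \<psi> \<phi> i \<le> compose {1..l} \<psi> \<phi> j"
      using ij mono_onD[OF \<psi>(2)] by (simp add: compose_eq)
  qed
  then show "compose {1..l} \<psi> \<phi> \<in> Hom Ord_fin l n"
    using \<phi>(1) \<psi>(1) by (simp add: Ord_fin_def compose_in_PiE)
next
  fix n
  show "(\<lambda>k\<in>{1..n}. k) \<in> Hom Ord_fin n n"
    by (auto simp: Ord_fin_def mono_on_def)
qed (simp_all add: Ord_fin_def)

lemma is_category_FinSets: "is_category FinSets"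
  by (rule is_category_concrete[where c = "\<lambda>A. A"])
    (simp_all add: FinSets_def compose_in_PiE)

lemma entourage_subset:
  "\<lbrakk>is_uspace M; V \<in> entourages M\<rbrakk> \<Longrightarrow> V \<subseteq> upoints M \<times> upoints M"
  by (auto simp: is_uspace_def is_filt_def)

lemma is_category_UniformSpaces: "is_category UniformSpaces"
proof (rule is_category_concrete[where c = upoints])
  fix M N P f g
  assume "M \<in> Ob UniformSpaces" and f: "f \<in> Hom UniformSpaces M N" and g: "g \<in> Hom UniformSpaces N P"
  then have M: "is_uspace M" by (simp add: UniformSpaces_def)
  have "\<exists>U\<in>entourages M. \<forall>(x, y)\<in>U. (compose (upoints M) g f x, compose (upoints M) g f y) \<in> W"
    if W: "W \<in> entourages P" for W
  proof -
    obtain V where V: "V \<in> entourages N" "\<forall>(x, y)\<in>V. (g x, g y) \<in> W"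
      using g W by (auto simp: UniformSpaces_def)
    obtain U where U: "U \<in> entourages M" "\<forall>(x, y)\<in>U. (f x, f y) \<in> V"
      using f V(1) by (auto simp: UniformSpaces_def)
    have "(compose (upoints M) g f x, compose (upoints M) g f y) \<in> W" if "(x, y) \<in> U" for x y
    proof -
      have "x \<in> upoints M" "y \<in> upoints M"
        using entourage_subset[OF M U(1)] that by auto
      then show ?thesis using U(2) V(2) that by (auto simp: compose_eq)
    qed
    then show ?thesis using U(1) by blast
  qed
  then show "compose (upoints M) g f \<in> Hom UniformSpaces M P"
    using f g by (simp add: UniformSpaces_def compose_in_PiE[of f _ "upoints N"])
next
  fix M :: "'a uspace" assume "M \<in> Ob UniformSpaces"
  then have M: "is_uspace M" by (simp add: UniformSpaces_def)
  have "\<exists>U\<in>entourages M. \<forall>(x, y)\<in>U. ((\<lambda>x\<in>upoints M. x) x, (\<lambda>x\<in>upoints M. x) y) \<in> V"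
    if "V \<in> entourages M" for V
    using that entourage_subset[OF M that] by (intro bexI[of _ V]) auto
  then show "(\<lambda>x\<in>upoints M. x) \<in> Hom UniformSpaces M M"
    by (simp add: UniformSpaces_def)
qed (auto simp: UniformSpaces_def)

lemma is_functor_Forget: "is_functor Ord_fin FinSets Forget"
  unfolding Forget_def
  by (rule is_functor_mk_functor[OF is_category_Ord_fin is_category_FinSets])
    (auto simp: Ord_fin_def FinSets_def)


section \<open>Powers of a uniform space indexed by finite sets\<close>

text \<open>
  The filter of topoic subsets for an arbitrary index set. For \<open>A = {}\<close> the closeness condition is
  vacuous, so over a uniform space the whole one-point set is the only big subset, in agreement
  with \<open>topoic M 0\<close>.
\<close>

definition power_filt :: "'a uspace \<Rightarrow> 'i set \<Rightarrow> ('i \<Rightarrow> 'a) filt" where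
  "power_filt M A =
     \<lparr> points = A \<rightarrow>\<^sub>E upoints M,
       big = {P. P \<subseteq> (A \<rightarrow>\<^sub>E upoints M) \<and>
         (\<exists>V\<in>entourages M. \<forall>x\<in>A \<rightarrow>\<^sub>E upoints M. (\<forall>i\<in>A. \<forall>j\<in>A. (x i, x j) \<in> V) \<longrightarrow> x \<in> P)} \<rparr>"

lemma points_power_filt: "points (power_filt M A) = A \<rightarrow>\<^sub>E upoints M"
  by (simp add: power_filt_def)

lemma big_power_filtI:
  assumes "V \<in> entourages M" and "P \<subseteq> A \<rightarrow>\<^sub>E upoints M"
    and "\<And>x. \<lbrakk>x \<in> A \<rightarrow>\<^sub>E upoints M; \<forall>i\<in>A. \<forall>j\<in>A. (x i, x j) \<in> V\<rbrakk> \<Longrightarrow> x \<in> P"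
  shows "P \<in> big (power_filt M A)"
  using assms unfolding power_filt_def by (simp, blast)

lemma big_power_filtE:
  assumes "P \<in> big (power_filt M A)"
  obtains V where "V \<in> entourages M"
    and "\<And>x. \<lbrakk>x \<in> A \<rightarrow>\<^sub>E upoints M; \<forall>i\<in>A. \<forall>j\<in>A. (x i, x j) \<in> V\<rbrakk> \<Longrightarrow> x \<in> P"
  using assms unfolding power_filt_def by (simp, blast)

lemma is_filt_power_filt:
  assumes "is_uspace M" shows "is_filt (power_filt M A)"
proof -
  have M: "upoints M \<times> upoints M \<in> entourages M"
    "\<And>U V. \<lbrakk>U \<in> entourages M; V \<in> entourages M\<rbrakk> \<Longrightarrow> U \<inter> V \<in> entourages M"
    using assms by (auto simp: is_uspace_def is_filt_def)
  have sub: "P \<subseteq> A \<rightarrow>\<^sub>E upoints M" if "P \<in> big (power_filt M A)" for P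
    using that by (simp add: power_filt_def)
  have "P \<inter> Q \<in> big (power_filt M A)"
    if P: "P \<in> big (power_filt M A)" and Q: "Q \<in> big (power_filt M A)" for P Q
  proof -
    obtain U where U: "U \<in> entourages M"
      "\<And>x. \<lbrakk>x \<in> A \<rightarrow>\<^sub>E upoints M; \<forall>i\<in>A. \<forall>j\<in>A. (x i, x j) \<in> U\<rbrakk> \<Longrightarrow> x \<in> P"
      using P by (rule big_power_filtE) (rule that)
    obtain V where V: "V \<in> entourages M"
      "\<And>x. \<lbrakk>x \<in> A \<rightarrow>\<^sub>E upoints M; \<forall>i\<in>A. \<forall>j\<in>A. (x i, x j) \<in> V\<rbrakk> \<Longrightarrow> x \<in> Q"
      using Q by (rule big_power_filtE) (rule that)
    show ?thesis
    proof (rule big_power_filtI[OF M(2)[OF U(1) V(1)]])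
      show "P \<inter> Q \<subseteq> A \<rightarrow>\<^sub>E upoints M" using sub[OF P] by (rule le_infI1)
      fix x assume "x \<in> A \<rightarrow>\<^sub>E upoints M" "\<forall>i\<in>A. \<forall>j\<in>A. (x i, x j) \<in> U \<inter> V"
      then show "x \<in> P \<inter> Q" by (intro IntI U(2) V(2)) simp_all
    qed
  qed
  moreover have "Q \<in> big (power_filt M A)"
    if P: "P \<in> big (power_filt M A)" and Q: "P \<subseteq> Q" "Q \<subseteq> points (power_filt M A)" for P Q
  proof -
    obtain V where V: "V \<in> entourages M"
      "\<And>x. \<lbrakk>x \<in> A \<rightarrow>\<^sub>E upoints M; \<forall>i\<in>A. \<forall>j\<in>A. (x i, x j) \<in> V\<rbrakk> \<Longrightarrow> x \<in> P"
      using P by (rule big_power_filtE) (rule that)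
    show ?thesis
      using V(1) Q(2)[unfolded points_power_filt]
      by (rule big_power_filtI) (rule subsetD[OF Q(1) V(2)])
  qed
  moreover have "points (power_filt M A) \<in> big (power_filt M A)"
    using M(1) unfolding points_power_filt by (rule big_power_filtI) simp_all
  moreover have "big (power_filt M A) \<subseteq> Pow (points (power_filt M A))"
    using sub unfolding points_power_filt by blast
  ultimately show ?thesis
    unfolding is_filt_def by meson
qed

lemma power_filt_eq_topoic:
  assumes "is_uspace M"
  shows "power_filt M {1..n} = \<lparr> points = tuples (upoints M) n, big = topoic M n \<rparr>"
proof (cases "n = 0")
  case True
  have "entourages M \<noteq> {}" using assms by (auto simp: is_uspace_def is_filt_def)
  then show ?thesis
    using True by (auto simp: power_filt_def topoic_def tuples_def)
qed (auto simp: power_filt_def topoic_def tuples_def)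

definition finite_powers ::
  "'a uspace \<Rightarrow> (nat set, nat \<Rightarrow> nat, (nat \<Rightarrow> 'a) filt, (nat \<Rightarrow> 'a) \<Rightarrow> (nat \<Rightarrow> 'a)) fctr" where
  "finite_powers M = mk_functor (opp FinSets) (power_filt M)
     (\<lambda>A B \<phi>. \<lambda>x\<in>A \<rightarrow>\<^sub>E upoints M. \<lambda>k\<in>B. x (\<phi> k))"

text \<open>
  The coordinates of \<open>x \<circ> \<phi>\<close> are among those of \<open>x\<close>, so an entourage that witnesses \<open>P\<close> in the
  power \<open>B\<close> also witnesses its preimage in the power \<open>A\<close>. That \<open>\<phi>\<close> ranges over all
  maps, monotone or not, is what makes \<open>\<mu>\<close> factor through finite sets.
\<close>

lemma reindex_in_Hom:
  assumes \<phi>: "\<phi> \<in> B \<rightarrow> A"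
  shows "(\<lambda>x\<in>A \<rightarrow>\<^sub>E upoints M. \<lambda>k\<in>B. x (\<phi> k)) \<in> Hom Filt (power_filt M A) (power_filt M B)"
proof -
  have rm: "(\<lambda>k\<in>B. x (\<phi> k)) \<in> B \<rightarrow>\<^sub>E upoints M" if "x \<in> A \<rightarrow>\<^sub>E upoints M" for x
    using that \<phi> by auto
  have "{x \<in> A \<rightarrow>\<^sub>E upoints M. (\<lambda>k\<in>B. x (\<phi> k)) \<in> P} \<in> big (power_filt M A)"
    if P: "P \<in> big (power_filt M B)" for P
  proof -
    obtain V where V: "V \<in> entourages M"
      "\<And>x. \<lbrakk>x \<in> B \<rightarrow>\<^sub>E upoints M; \<forall>i\<in>B. \<forall>j\<in>B. (x i, x j) \<in> V\<rbrakk> \<Longrightarrow> x \<in> P"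
      using P by (rule big_power_filtE) (rule that)
    have "(\<lambda>k\<in>B. x (\<phi> k)) \<in> P"
      if "x \<in> A \<rightarrow>\<^sub>E upoints M" "\<forall>i\<in>A. \<forall>j\<in>A. (x i, x j) \<in> V" for x
      using that(2) \<phi> by (intro V(2) rm that(1)) (auto simp: Pi_iff)
    then show ?thesis
      by (intro big_power_filtI[OF V(1)]) auto
  qed
  then show ?thesis
    using rm by (simp add: Filt_def points_power_filt cong: conj_cong)
qed

lemma is_functor_finite_powers:
  assumes "is_uspace M"
  shows "is_functor (opp FinSets) Filt (finite_powers M)"
  unfolding finite_powers_def
proof (rule is_functor_mk_functor[OF is_category_opp[OF is_category_FinSets] is_category_Filt])
  fix A show "power_filt M A \<in> Ob Filt"
    using is_filt_power_filt[OF assms] by (simp add: Filt_def)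
next
  fix A B \<phi> assume "\<phi> \<in> Hom (opp FinSets) A B"
  then show "(\<lambda>x\<in>A \<rightarrow>\<^sub>E upoints M. \<lambda>k\<in>B. x (\<phi> k)) \<in> Hom Filt (power_filt M A) (power_filt M B)"
    by (intro reindex_in_Hom) (auto simp: opp_def FinSets_def)
next
  fix A
  show "(\<lambda>x\<in>A \<rightarrow>\<^sub>E upoints M. \<lambda>k\<in>A. x (Idt (opp FinSets) A k)) = Idt Filt (power_filt M A)"
  proof -
    have "(\<lambda>x\<in>A \<rightarrow>\<^sub>E upoints M. \<lambda>k\<in>A. x ((\<lambda>k\<in>A. k) k)) = (\<lambda>x\<in>A \<rightarrow>\<^sub>E upoints M. x)"
    proof (rule restrict_ext)
      fix x assume "x \<in> A \<rightarrow>\<^sub>E upoints M"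
      then have "(\<lambda>k\<in>A. x k) = x" by (rule PiE_restrict)
      moreover have "(\<lambda>k\<in>A. x ((\<lambda>k\<in>A. k) k)) = (\<lambda>k\<in>A. x k)"
        by (rule restrict_ext) simp
      ultimately show "(\<lambda>k\<in>A. x ((\<lambda>k\<in>A. k) k)) = x" by (rule trans[rotated])
    qed
    then show ?thesis
      unfolding Filt_def opp_def FinSets_def cat.simps points_power_filt .
  qed
next
  fix A B C \<phi> \<psi>
  assume "\<phi> \<in> Hom (opp FinSets) A B" "\<psi> \<in> Hom (opp FinSets) B C"
  then have \<phi>: "\<phi> \<in> B \<rightarrow>\<^sub>E A" and \<psi>: "\<psi> \<in> C \<rightarrow>\<^sub>E B" by (auto simp: opp_def FinSets_def)
  have "(\<lambda>x\<in>A \<rightarrow>\<^sub>E upoints M. \<lambda>k\<in>C. x (compose C \<phi> \<psi> k)) =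
      compose (A \<rightarrow>\<^sub>E upoints M)
        (\<lambda>x\<in>B \<rightarrow>\<^sub>E upoints M. \<lambda>k\<in>C. x (\<psi> k)) (\<lambda>x\<in>A \<rightarrow>\<^sub>E upoints M. \<lambda>k\<in>B. x (\<phi> k))"
    unfolding compose_def
  proof (rule restrict_ext)
    fix x assume x: "x \<in> A \<rightarrow>\<^sub>E upoints M"
    have "(\<lambda>k\<in>B. x (\<phi> k)) \<in> B \<rightarrow>\<^sub>E upoints M"
      using x \<phi> by (intro restrict_PiE_iff[THEN iffD2]) blast
    then show "(\<lambda>k\<in>C. x ((\<lambda>k\<in>C. \<phi> (\<psi> k)) k)) =
        (\<lambda>x\<in>B \<rightarrow>\<^sub>E upoints M. \<lambda>k\<in>C. x (\<psi> k)) ((\<lambda>x\<in>A \<rightarrow>\<^sub>E upoints M. \<lambda>k\<in>B. x (\<phi> k)) x)"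
      using x PiE_mem[OF \<psi>] by (auto intro!: restrict_ext)
  qed
  then show "(\<lambda>x\<in>A \<rightarrow>\<^sub>E upoints M. \<lambda>k\<in>C. x (Comp (opp FinSets) A B C \<psi> \<phi> k)) =
      Comp Filt (power_filt M A) (power_filt M B) (power_filt M C)
        (\<lambda>x\<in>B \<rightarrow>\<^sub>E upoints M. \<lambda>k\<in>C. x (\<psi> k)) (\<lambda>x\<in>A \<rightarrow>\<^sub>E upoints M. \<lambda>k\<in>B. x (\<phi> k))"
    unfolding Filt_def opp_def FinSets_def cat.simps points_power_filt .
qed

lemma opp_Forget_apply:
  "on_ob (opp_functor Ord_fin Forget) n = {1..n}"
  "\<phi> \<in> Hom (opp Ord_fin) n m \<Longrightarrow> on_hom (opp_functor Ord_fin Forget) n m \<phi> = \<phi>"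
proof -
  have Ob: "n \<in> Ob Ord_fin" "n \<in> Ob (opp Ord_fin)" for n
    by (simp_all add: opp_def Ord_fin_def)
  show "on_ob (opp_functor Ord_fin Forget) n = {1..n}"
    unfolding opp_functor_def Forget_def by (simp only: mk_functor_apply Ob)
  assume \<phi>: "\<phi> \<in> Hom (opp Ord_fin) n m"
  then have "\<phi> \<in> Hom Ord_fin m n" by (simp add: opp_def)
  with \<phi> show "on_hom (opp_functor Ord_fin Forget) n m \<phi> = \<phi>"
    unfolding opp_functor_def Forget_def by (simp only: mk_functor_apply Ob)
qed

lemma mu_ob_factors:
  assumes "is_uspace M"
  shows "mu_ob M = comp_functor (opp Ord_fin) (finite_powers M) (opp_functor Ord_fin Forget)"
  unfolding mu_ob_def powers_functor_def comp_functor_def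
proof (rule mk_functor_cong)
  have Ob: "{1..n} \<in> Ob (opp FinSets)" for n
    by (simp add: opp_def FinSets_def)
  {
    fix n
    show "\<lparr>points = tuples (upoints M) n, big = topoic M n\<rparr> =
        on_ob (finite_powers M) (on_ob (opp_functor Ord_fin Forget) n)"
      unfolding opp_Forget_apply finite_powers_def mk_functor_apply(1)[OF Ob]
      by (rule power_filt_eq_topoic[OF assms, symmetric])
  next
    fix n m \<phi> assume \<phi>: "\<phi> \<in> Hom (opp Ord_fin) n m"
    then have "\<phi> \<in> Hom (opp FinSets) {1..n} {1..m}"
      by (simp add: opp_def Ord_fin_def FinSets_def)
    then show "(\<lambda>x\<in>tuples (upoints M) n. \<lambda>k\<in>{1..m}. x (\<phi> k)) =
        on_hom (finite_powers M) (on_ob (opp_functor Ord_fin Forget) n)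
          (on_ob (opp_functor Ord_fin Forget) m) (on_hom (opp_functor Ord_fin Forget) n m \<phi>)"
      unfolding opp_Forget_apply(1) opp_Forget_apply(2)[OF \<phi>] finite_powers_def tuples_def
      by (simp only: mk_functor_apply(2)[OF Ob Ob])
  }
qed

lemma is_functor_mu_ob:
  "is_uspace M \<Longrightarrow> is_functor (opp Ord_fin) Filt (mu_ob M)"
  unfolding mu_ob_factors
  by (rule is_functor_comp_functor[OF is_functor_opp_functor[OF is_functor_Forget]
        is_functor_finite_powers])

text \<open>
  Stating the values by \<open>power_filt\<close> instead of \<open>topoic\<close> treats the power \<open>n = 0\<close> like all others.
\<close>

lemma mu_ob_apply:
  "is_uspace M \<Longrightarrow> on_ob (mu_ob M) n = power_filt M {1..n}"
  "\<phi> \<in> Hom (opp Ord_fin) n m \<Longrightarrow>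
     on_hom (mu_ob M) n m \<phi> = (\<lambda>x\<in>{1..n} \<rightarrow>\<^sub>E upoints M. \<lambda>k\<in>{1..m}. x (\<phi> k))"
proof -
  show "on_ob (mu_ob M) n = power_filt M {1..n}" if "is_uspace M"
    using power_filt_eq_topoic[OF that, of n]
    by (simp add: mu_ob_def powers_functor_def mk_functor_def opp_def Ord_fin_def)
  show "\<phi> \<in> Hom (opp Ord_fin) n m \<Longrightarrow>
     on_hom (mu_ob M) n m \<phi> = (\<lambda>x\<in>{1..n} \<rightarrow>\<^sub>E upoints M. \<lambda>k\<in>{1..m}. x (\<phi> k))"
    unfolding mu_ob_def powers_functor_def tuples_def
    by (subst mk_functor_apply) (simp_all add: opp_def Ord_fin_def)
qed


section \<open>Uniformly continuous maps as natural transformations\<close>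

lemma power_map_in_Hom:
  assumes f: "f \<in> Hom UniformSpaces M N"
  shows "(\<lambda>x\<in>A \<rightarrow>\<^sub>E upoints M. \<lambda>k\<in>A. f (x k)) \<in> Hom Filt (power_filt M A) (power_filt N A)"
proof -
  have rm: "(\<lambda>k\<in>A. f (x k)) \<in> A \<rightarrow>\<^sub>E upoints N" if "x \<in> A \<rightarrow>\<^sub>E upoints M" for x
    using that f by (auto simp: UniformSpaces_def)
  have "{x \<in> A \<rightarrow>\<^sub>E upoints M. (\<lambda>k\<in>A. f (x k)) \<in> P} \<in> big (power_filt M A)"
    if P: "P \<in> big (power_filt N A)" for P
  proof -
    obtain V where V: "V \<in> entourages N"
      "\<And>x. \<lbrakk>x \<in> A \<rightarrow>\<^sub>E upoints N; \<forall>i\<in>A. \<forall>j\<in>A. (x i, x j) \<in> V\<rbrakk> \<Longrightarrow> x \<in> P"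
      using P by (rule big_power_filtE) (rule that)
    obtain U where U: "U \<in> entourages M" "\<forall>(x, y)\<in>U. (f x, f y) \<in> V"
      using f V(1) by (auto simp: UniformSpaces_def)
    have "(\<lambda>k\<in>A. f (x k)) \<in> P"
      if "x \<in> A \<rightarrow>\<^sub>E upoints M" "\<forall>i\<in>A. \<forall>j\<in>A. (x i, x j) \<in> U" for x
      using that(2) U(2) by (intro V(2) rm that(1)) auto
    then show ?thesis
      by (intro big_power_filtI[OF U(1)]) auto
  qed
  then show ?thesis
    using rm by (simp add: Filt_def points_power_filt cong: conj_cong)
qed

lemma powers_map_apply:
  "powers_map S f n = (\<lambda>x\<in>{1..n} \<rightarrow>\<^sub>E S. \<lambda>k\<in>{1..n}. f (x k))"
  by (simp add: powers_map_def tuples_def opp_def Ord_fin_def)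

lemma powers_map_in_nat_trans:
  assumes M: "is_uspace M" and N: "is_uspace N" and f: "f \<in> Hom UniformSpaces M N"
  shows "powers_map (upoints M) f \<in> nat_trans (opp Ord_fin) Filt (mu_ob M) (mu_ob N)"
proof -
  have fm: "f \<in> upoints M \<rightarrow> upoints N"
    using f by (auto simp: UniformSpaces_def)
  have "Comp Filt (on_ob (mu_ob M) n) (on_ob (mu_ob M) m) (on_ob (mu_ob N) m)
          (powers_map (upoints M) f m) (on_hom (mu_ob M) n m \<phi>) =
        Comp Filt (on_ob (mu_ob M) n) (on_ob (mu_ob N) n) (on_ob (mu_ob N) m)
          (on_hom (mu_ob N) n m \<phi>) (powers_map (upoints M) f n)"
    if \<phi>: "\<phi> \<in> Hom (opp Ord_fin) n m" for n m \<phi>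
  proof -
    have \<phi>m: "\<phi> k \<in> {1..n}" if "k \<in> {1..m}" for k
      using \<phi> that by (auto simp: opp_def Ord_fin_def)
    have "compose ({1..n} \<rightarrow>\<^sub>E upoints M) (\<lambda>x\<in>{1..m} \<rightarrow>\<^sub>E upoints M. \<lambda>k\<in>{1..m}. f (x k))
            (\<lambda>x\<in>{1..n} \<rightarrow>\<^sub>E upoints M. \<lambda>k\<in>{1..m}. x (\<phi> k)) =
          compose ({1..n} \<rightarrow>\<^sub>E upoints M) (\<lambda>x\<in>{1..n} \<rightarrow>\<^sub>E upoints N. \<lambda>k\<in>{1..m}. x (\<phi> k))
            (\<lambda>x\<in>{1..n} \<rightarrow>\<^sub>E upoints M. \<lambda>k\<in>{1..n}. f (x k))"
      unfolding compose_def
    proof (rule restrict_ext)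
      fix x assume x: "x \<in> {1..n} \<rightarrow>\<^sub>E upoints M"
      have "(\<lambda>k\<in>{1..m}. x (\<phi> k)) \<in> {1..m} \<rightarrow>\<^sub>E upoints M"
        using PiE_mem[OF x \<phi>m] by (intro restrict_PiE_iff[THEN iffD2]) blast
      moreover have "(\<lambda>k\<in>{1..n}. f (x k)) \<in> {1..n} \<rightarrow>\<^sub>E upoints N"
        using x fm by (intro restrict_PiE_iff[THEN iffD2]) blast
      ultimately show "(\<lambda>x\<in>{1..m} \<rightarrow>\<^sub>E upoints M. \<lambda>k\<in>{1..m}. f (x k))
            ((\<lambda>x\<in>{1..n} \<rightarrow>\<^sub>E upoints M. \<lambda>k\<in>{1..m}. x (\<phi> k)) x) =
          (\<lambda>x\<in>{1..n} \<rightarrow>\<^sub>E upoints N. \<lambda>k\<in>{1..m}. x (\<phi> k))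
            ((\<lambda>x\<in>{1..n} \<rightarrow>\<^sub>E upoints M. \<lambda>k\<in>{1..n}. f (x k)) x)"
        using x \<phi>m by (simp del: atLeastAtMost_iff cong: restrict_cong)
    qed
    then show ?thesis
      unfolding mu_ob_apply(1)[OF M] mu_ob_apply(1)[OF N] mu_ob_apply(2)[OF \<phi>] powers_map_apply
      by (simp add: Filt_def points_power_filt)
  qed
  moreover have "powers_map (upoints M) f \<in>
      (\<Pi>\<^sub>E n\<in>Ob (opp Ord_fin). Hom Filt (on_ob (mu_ob M) n) (on_ob (mu_ob N) n))"
    using power_map_in_Hom[OF f]
    by (auto simp: mu_ob_apply(1) M N powers_map_apply opp_def Ord_fin_def)
  ultimately show ?thesis
    by (simp add: nat_trans_def)
qed

lemma is_functor_mu: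
  "is_functor UniformSpaces (FunctorCat (opp Ord_fin) Filt) mu"
  unfolding mu_def
proof (rule is_functor_mk_functor[OF is_category_UniformSpaces is_category_FunctorCat[OF is_category_Filt]])
  fix M :: "'a uspace" assume "M \<in> Ob UniformSpaces"
  then have M: "is_uspace M" by (simp add: UniformSpaces_def)
  then show "mu_ob M \<in> Ob (FunctorCat (opp Ord_fin) Filt)"
    by (simp add: FunctorCat_def is_functor_mu_ob)
  show "powers_map (upoints M) (Idt UniformSpaces M) = Idt (FunctorCat (opp Ord_fin) Filt) (mu_ob M)"
  proof
    fix n :: nat
    have "(\<lambda>x\<in>{1..n} \<rightarrow>\<^sub>E upoints M. \<lambda>k\<in>{1..n}. (\<lambda>a\<in>upoints M. a) (x k)) =
        (\<lambda>x\<in>{1..n} \<rightarrow>\<^sub>E upoints M. x)"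
    proof (rule restrict_ext)
      fix x assume x: "x \<in> {1..n} \<rightarrow>\<^sub>E upoints M"
      have "(\<lambda>k\<in>{1..n}. (\<lambda>a\<in>upoints M. a) (x k)) = (\<lambda>k\<in>{1..n}. x k)"
        by (rule restrict_ext) (simp add: PiE_mem[OF x])
      also have "\<dots> = x" using x by (rule PiE_restrict)
      finally show "(\<lambda>k\<in>{1..n}. (\<lambda>a\<in>upoints M. a) (x k)) = x" .
    qed
    then show "powers_map (upoints M) (Idt UniformSpaces M) n =
        Idt (FunctorCat (opp Ord_fin) Filt) (mu_ob M) n"
      by (simp add: powers_map_apply UniformSpaces_def FunctorCat_def Filt_def mu_ob_apply(1)[OF M]
          points_power_filt opp_def Ord_fin_def)
  qed
next
  fix M N :: "'a uspace" and f
  assume "M \<in> Ob UniformSpaces" "N \<in> Ob UniformSpaces" "f \<in> Hom UniformSpaces M N"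
  then show "powers_map (upoints M) f \<in> Hom (FunctorCat (opp Ord_fin) Filt) (mu_ob M) (mu_ob N)"
    by (simp add: FunctorCat_def powers_map_in_nat_trans UniformSpaces_def)
next
  fix M N P :: "'a uspace" and f g
  assume "M \<in> Ob UniformSpaces" and f: "f \<in> Hom UniformSpaces M N"
  then have M: "is_uspace M"
    by (simp add: UniformSpaces_def)
  have fm: "f \<in> upoints M \<rightarrow> upoints N"
    using f by (auto simp: UniformSpaces_def)
  show "powers_map (upoints M) (Comp UniformSpaces M N P g f) =
      Comp (FunctorCat (opp Ord_fin) Filt) (mu_ob M) (mu_ob N) (mu_ob P)
        (powers_map (upoints N) g) (powers_map (upoints M) f)"
  proof
    fix n :: nat
    have "(\<lambda>x\<in>{1..n} \<rightarrow>\<^sub>E upoints M. \<lambda>k\<in>{1..n}. compose (upoints M) g f (x k)) =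
      compose ({1..n} \<rightarrow>\<^sub>E upoints M) (\<lambda>x\<in>{1..n} \<rightarrow>\<^sub>E upoints N. \<lambda>k\<in>{1..n}. g (x k))
        (\<lambda>x\<in>{1..n} \<rightarrow>\<^sub>E upoints M. \<lambda>k\<in>{1..n}. f (x k))"
      unfolding compose_def
    proof (rule restrict_ext)
      fix x assume x: "x \<in> {1..n} \<rightarrow>\<^sub>E upoints M"
      have "(\<lambda>k\<in>{1..n}. f (x k)) \<in> {1..n} \<rightarrow>\<^sub>E upoints N"
        using x fm by (intro restrict_PiE_iff[THEN iffD2]) blast
      then show "(\<lambda>k\<in>{1..n}. (\<lambda>a\<in>upoints M. g (f a)) (x k)) =
          (\<lambda>x\<in>{1..n} \<rightarrow>\<^sub>E upoints N. \<lambda>k\<in>{1..n}. g (x k))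
            ((\<lambda>x\<in>{1..n} \<rightarrow>\<^sub>E upoints M. \<lambda>k\<in>{1..n}. f (x k)) x)"
        using x PiE_mem[OF x] by (simp del: atLeastAtMost_iff cong: restrict_cong)
    qed
    then show "powers_map (upoints M) (Comp UniformSpaces M N P g f) n =
      Comp (FunctorCat (opp Ord_fin) Filt) (mu_ob M) (mu_ob N) (mu_ob P)
        (powers_map (upoints N) g) (powers_map (upoints M) f) n"
      by (simp add: powers_map_apply UniformSpaces_def FunctorCat_def Filt_def
          mu_ob_apply(1)[OF M] points_power_filt opp_def Ord_fin_def)
  qed
qed

text \<open>
  Faithfulness: \<open>f\<close> can be read off from its action on one-element tuples.
\<close>

lemma powers_map_inject:
  assumes f: "f \<in> extensional S" and g: "g \<in> extensional S"
    and eq: "powers_map S f = powers_map S g"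
  shows "f = g"
proof (rule extensionalityI[OF f g])
  fix a assume "a \<in> S"
  moreover have "powers_map S f 1 (\<lambda>k\<in>{1}. a) 1 = powers_map S g 1 (\<lambda>k\<in>{1}. a) 1"
    by (simp add: eq)
  ultimately show "f a = g a"
    by (simp add: powers_map_apply)
qed

text \<open>
  Naturality along the map \<open>{1} \<rightarrow> {1..n}\<close> with value \<open>i\<close> says that the \<open>i\<close>-th coordinate of \<open>\<eta> n x\<close>
  is \<open>\<eta> 1\<close> applied to the \<open>i\<close>-th coordinate of \<open>x\<close>. Uniform continuity of \<open>f\<close> is a separate matter,
  settled by the next lemma.
\<close>

lemma nat_trans_mu_ob_is_powers_map:
  assumes M: "is_uspace M" and N: "is_uspace N"
    and \<eta>: "\<eta> \<in> nat_trans (opp Ord_fin) Filt (mu_ob M) (mu_ob N)"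
  obtains f where "f \<in> upoints M \<rightarrow>\<^sub>E upoints N" and "\<eta> = powers_map (upoints M) f"
proof
  define f where "f = (\<lambda>a\<in>upoints M. \<eta> 1 (\<lambda>k\<in>{1}. a) 1)"
  have \<eta>m: "\<eta> n \<in> ({1..n} \<rightarrow>\<^sub>E upoints M) \<rightarrow>\<^sub>E ({1..n} \<rightarrow>\<^sub>E upoints N)" for n
    using nat_transD(1)[OF \<eta>, of n]
    by (auto simp: mu_ob_apply(1) M N Filt_def power_filt_def opp_def Ord_fin_def)
  show "f \<in> upoints M \<rightarrow>\<^sub>E upoints N"
    using \<eta>m[of 1] by (fastforce simp: f_def PiE_iff)
  have coord: "\<eta> n x i = f (x i)" if x: "x \<in> {1..n} \<rightarrow>\<^sub>E upoints M" and i: "i \<in> {1..n}" for n x i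
  proof -
    let ?\<phi> = "\<lambda>k\<in>{1..1::nat}. i"
    have \<phi>: "?\<phi> \<in> Hom (opp Ord_fin) n 1"
      using i by (auto simp: opp_def Ord_fin_def mono_on_def)
    have "Comp Filt (on_ob (mu_ob M) n) (on_ob (mu_ob M) 1) (on_ob (mu_ob N) 1)
            (\<eta> 1) (on_hom (mu_ob M) n 1 ?\<phi>) x 1 =
          Comp Filt (on_ob (mu_ob M) n) (on_ob (mu_ob N) n) (on_ob (mu_ob N) 1)
            (on_hom (mu_ob N) n 1 ?\<phi>) (\<eta> n) x 1"
      using nat_transD(2)[OF \<eta> _ _ \<phi>] by (simp add: opp_def Ord_fin_def)
    moreover have "\<eta> n x \<in> {1..n} \<rightarrow>\<^sub>E upoints N" "x i \<in> upoints M"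
      using \<eta>m[of n] x i by auto
    ultimately show ?thesis
      unfolding mu_ob_apply(1)[OF M] mu_ob_apply(1)[OF N] mu_ob_apply(2)[OF \<phi>]
      using x i by (simp add: Filt_def power_filt_def compose_def f_def cong: restrict_cong)
  qed
  show "\<eta> = powers_map (upoints M) f"
  proof
    fix n
    show "\<eta> n = powers_map (upoints M) f n"
      unfolding powers_map_apply
    proof (rule extensionalityI[of _ "{1..n} \<rightarrow>\<^sub>E upoints M"])
      fix x assume x: "x \<in> {1..n} \<rightarrow>\<^sub>E upoints M"
      then have "\<eta> n x \<in> extensional {1..n}" using \<eta>m[of n] by (auto simp: PiE_iff)
      then show "\<eta> n x = (\<lambda>x\<in>{1..n} \<rightarrow>\<^sub>E upoints M. \<lambda>k\<in>{1..n}. f (x k)) x"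
        using x coord[OF x] by (auto intro!: extensionalityI)
    qed (use \<eta>m[of n] in \<open>auto simp: PiE_iff\<close>)
  qed
qed

text \<open>
  Pulling back the topoic subset \<open>V\<close> of the square of \<open>N\<close> gives an entourage \<open>U\<close> of \<open>M\<close> that
  controls pairs \<open>(a, b)\<close> all four of whose coordinate pairs lie in \<open>U\<close>. Since \<open>U\<close> contains the
  diagonal, that condition says only that \<open>(a, b)\<close> lies in the symmetric entourage \<open>U \<inter> U\<inverse>\<close>.
\<close>

lemma uniformly_continuous_if_square_in_Hom:
  assumes M: "is_uspace M" and f: "f \<in> upoints M \<rightarrow>\<^sub>E upoints N"
    and sq: "powers_map (upoints M) f 2 \<in> Hom Filt (power_filt M {1..2}) (power_filt N {1..2})"
  shows "f \<in> Hom UniformSpaces M N"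
proof -
  have "\<exists>U\<in>entourages M. \<forall>(a, b)\<in>U. (f a, f b) \<in> V" if V: "V \<in> entourages N" for V
  proof -
    let ?P = "{y \<in> {1..2} \<rightarrow>\<^sub>E upoints N. (y 1, y (2::nat)) \<in> V}"
    have "?P \<in> big (power_filt N {1..2})"
      by (rule big_power_filtI[OF V]) auto
    then have "{x \<in> {1..2} \<rightarrow>\<^sub>E upoints M. powers_map (upoints M) f 2 x \<in> ?P} \<in> big (power_filt M {1..2})"
      using sq unfolding Filt_def points_power_filt cat.simps by blast
    then obtain U where U: "U \<in> entourages M"
      "\<And>x. \<lbrakk>x \<in> {1..2} \<rightarrow>\<^sub>E upoints M; \<forall>i\<in>{1..2}. \<forall>j\<in>{1..2}. (x i, x j) \<in> U\<rbrakk>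
         \<Longrightarrow> x \<in> {x \<in> {1..2} \<rightarrow>\<^sub>E upoints M. powers_map (upoints M) f 2 x \<in> ?P}"
      by (rule big_power_filtE) (rule that)
    have U': "U \<inter> U\<inverse> \<in> entourages M" and refl: "Id_on (upoints M) \<subseteq> U"
      using M U(1) by (auto simp: is_uspace_def is_filt_def)
    have "(f a, f b) \<in> V" if ab: "(a, b) \<in> U \<inter> U\<inverse>" for a b
    proof -
      have pts: "a \<in> upoints M" "b \<in> upoints M"
        using entourage_subset[OF M U(1)] ab by auto
      let ?x = "\<lambda>k\<in>{1..2::nat}. if k = 1 then a else b"
      have "?x \<in> {1..2} \<rightarrow>\<^sub>E upoints M" using pts by auto
      moreover have "\<forall>i\<in>{1..2}. \<forall>j\<in>{1..2}. (?x i, ?x j) \<in> U"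
        using ab refl pts by auto
      ultimately have "powers_map (upoints M) f 2 ?x \<in> ?P" using U(2)[of ?x] by blast
      then show ?thesis
        using \<open>?x \<in> _\<close> by (simp add: powers_map_apply)
    qed
    then show ?thesis using U' by blast
  qed
  then show ?thesis using f by (simp add: UniformSpaces_def)
qed

lemma fully_faithful_mu:
  "fully_faithful UniformSpaces (FunctorCat (opp Ord_fin) Filt) mu"
  unfolding fully_faithful_def
proof (intro ballI)
  fix M N :: "'a uspace"
  assume MN: "M \<in> Ob UniformSpaces" "N \<in> Ob UniformSpaces"
  then have M: "is_uspace M" and N: "is_uspace N" by (auto simp: UniformSpaces_def)
  have "bij_betw (powers_map (upoints M)) (Hom UniformSpaces M N)
      (nat_trans (opp Ord_fin) Filt (mu_ob M) (mu_ob N))"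
  proof (rule bij_betw_imageI)
    show "inj_on (powers_map (upoints M)) (Hom UniformSpaces M N)"
      by (auto intro!: inj_onI powers_map_inject simp: UniformSpaces_def PiE_iff)
    show "powers_map (upoints M) ` Hom UniformSpaces M N =
        nat_trans (opp Ord_fin) Filt (mu_ob M) (mu_ob N)"
    proof (intro equalityI subsetI)
      fix \<eta> assume \<eta>: "\<eta> \<in> nat_trans (opp Ord_fin) Filt (mu_ob M) (mu_ob N)"
      obtain f where f: "f \<in> upoints M \<rightarrow>\<^sub>E upoints N" "\<eta> = powers_map (upoints M) f"
        using nat_trans_mu_ob_is_powers_map[OF M N \<eta>] .
      then have "powers_map (upoints M) f 2 \<in> Hom Filt (power_filt M {1..2}) (power_filt N {1..2})"
        using nat_transD(1)[OF \<eta>, of 2] by (simp add: mu_ob_apply(1) M N opp_def Ord_fin_def)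
      then show "\<eta> \<in> powers_map (upoints M) ` Hom UniformSpaces M N"
        using uniformly_continuous_if_square_in_Hom[OF M f(1)] f(2) by blast
    qed (auto intro: powers_map_in_nat_trans[OF M N])
  qed
  then show "bij_betw (on_hom mu M N) (Hom UniformSpaces M N)
      (Hom (FunctorCat (opp Ord_fin) Filt) (on_ob mu M) (on_ob mu N))"
    using MN by (subst bij_betw_cong[where g = "powers_map (upoints M)"])
      (auto simp: mu_def mk_functor_apply FunctorCat_def)
qed


section \<open>Metric spaces\<close>

lemma upoints_metric_uspace: "upoints (metric_uspace m) = mspace m"
  by (simp add: metric_uspace_def)

lemma is_uspace_metric_uspace: "is_uspace (metric_uspace m)"
proof -
  have "V\<inverse> \<in> entourages (metric_uspace m)" if "V \<in> entourages (metric_uspace m)" for V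
    using that unfolding metric_uspace_def by (auto simp: mdist_commute)
  moreover have "\<exists>W\<in>entourages (metric_uspace m). W O W \<subseteq> V"
    if V: "V \<in> entourages (metric_uspace m)" for V
  proof -
    obtain e where e: "e > 0"
      "\<forall>x\<in>mspace m. \<forall>y\<in>mspace m. mdist m x y < e \<longrightarrow> (x, y) \<in> V"
      using V by (auto simp: metric_uspace_def)
    let ?W = "{(x, y). x \<in> mspace m \<and> y \<in> mspace m \<and> mdist m x y < e / 2}"
    have "?W \<in> entourages (metric_uspace m)"
      using e(1) by (auto simp: metric_uspace_def intro!: exI[of _ "e / 2"])
    moreover have "?W O ?W \<subseteq> V"
    proof clarify
      fix x y z
      assume *: "x \<in> mspace m" "y \<in> mspace m" "z \<in> mspace m" "mdist m x y < e / 2" "mdist m y z < e / 2"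
      then have "mdist m x z < e"
        using mdist_triangle[of x m y z] by linarith
      then show "(x, z) \<in> V" using e(2) * by blast
    qed
    ultimately show ?thesis by blast
  qed
  moreover have "U \<inter> V \<in> entourages (metric_uspace m)"
    if U: "U \<in> entourages (metric_uspace m)" and V: "V \<in> entourages (metric_uspace m)" for U V
  proof -
    obtain d where "d > 0" "\<forall>x\<in>mspace m. \<forall>y\<in>mspace m. mdist m x y < d \<longrightarrow> (x, y) \<in> U"
      using U by (auto simp: metric_uspace_def)
    moreover obtain e where "e > 0" "\<forall>x\<in>mspace m. \<forall>y\<in>mspace m. mdist m x y < e \<longrightarrow> (x, y) \<in> V"
      using V by (auto simp: metric_uspace_def)
    ultimately show ?thesis
      using U V by (auto simp: metric_uspace_def intro!: exI[of _ "min d e"])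
  qed
  moreover have "Id_on (mspace m) \<subseteq> V" if V: "V \<in> entourages (metric_uspace m)" for V
  proof -
    obtain e where e: "e > 0"
      "\<forall>x\<in>mspace m. \<forall>y\<in>mspace m. mdist m x y < e \<longrightarrow> (x, y) \<in> V"
      using V by (auto simp: metric_uspace_def)
    have "(x, x) \<in> V" if x: "x \<in> mspace m" for x
    proof -
      have "mdist m x x < e" using e(1) mdist_zero[OF x x] by simp
      then show ?thesis using e(2) x by blast
    qed
    then show ?thesis by (auto simp: Id_on_def)
  qed
  moreover have "V \<in> entourages (metric_uspace m)"
    if "U \<in> entourages (metric_uspace m)" "U \<subseteq> V" "V \<subseteq> mspace m \<times> mspace m" for U V
    using that unfolding metric_uspace_def uspace.simps by blast
  moreover have "mspace m \<times> mspace m \<in> entourages (metric_uspace m)"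
    by (auto simp: metric_uspace_def intro: zero_less_one)
  moreover have "entourages (metric_uspace m) \<subseteq> Pow (mspace m \<times> mspace m)"
    by (auto simp: metric_uspace_def)
  ultimately show ?thesis
    unfolding is_uspace_def is_filt_def filt.simps upoints_metric_uspace by meson
qed

text \<open>
  The metric definition bounds distances for \<open>i \<le> j\<close> only, which suffices by symmetry of the distance.
\<close>

lemma metric_topoic_eq: "metric_topoic m n = topoic (metric_uspace m) n"
proof (cases "n = 0")
  case False
  have "(\<exists>\<epsilon>>0. \<forall>x\<in>tuples (mspace m) n.
          (\<forall>i\<in>{1..n}. \<forall>j\<in>{i..n}. mdist m (x i) (x j) < \<epsilon>) \<longrightarrow> x \<in> P) \<longleftrightarrow>
        (\<exists>V\<in>entourages (metric_uspace m). \<forall>x\<in>tuples (mspace m) n.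
          (\<forall>i\<in>{1..n}. \<forall>j\<in>{1..n}. (x i, x j) \<in> V) \<longrightarrow> x \<in> P)" (is "?L \<longleftrightarrow> ?R") for P
  proof
    assume ?L
    then obtain e where e: "e > 0" "\<forall>x\<in>tuples (mspace m) n.
          (\<forall>i\<in>{1..n}. \<forall>j\<in>{i..n}. mdist m (x i) (x j) < e) \<longrightarrow> x \<in> P" by blast
    let ?V = "{(x, y). x \<in> mspace m \<and> y \<in> mspace m \<and> mdist m x y < e}"
    have "?V \<in> entourages (metric_uspace m)"
      using e(1) by (auto simp: metric_uspace_def)
    moreover have "\<forall>x\<in>tuples (mspace m) n. (\<forall>i\<in>{1..n}. \<forall>j\<in>{1..n}. (x i, x j) \<in> ?V) \<longrightarrow> x \<in> P"
      using e(2) by simp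
    ultimately show ?R by blast
  next
    assume ?R
    then obtain V e where V: "\<forall>x\<in>tuples (mspace m) n.
          (\<forall>i\<in>{1..n}. \<forall>j\<in>{1..n}. (x i, x j) \<in> V) \<longrightarrow> x \<in> P"
      and e: "e > 0" "\<forall>x\<in>mspace m. \<forall>y\<in>mspace m. mdist m x y < e \<longrightarrow> (x, y) \<in> V"
      by (auto simp: metric_uspace_def)
    have "x \<in> P" if x: "x \<in> tuples (mspace m) n"
      and d: "\<forall>i\<in>{1..n}. \<forall>j\<in>{i..n}. mdist m (x i) (x j) < e" for x
    proof -
      have "(x i, x j) \<in> V" if "i \<in> {1..n}" "j \<in> {1..n}" for i j
      proof -
        have "mdist m (x i) (x j) < e"
        proof (cases "i \<le> j")
          case True
          then show ?thesis using d that by simp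
        next
          case False
          then have "mdist m (x j) (x i) < e" using d that by simp
          then show ?thesis by (simp add: mdist_commute)
        qed
        moreover have "x i \<in> mspace m" "x j \<in> mspace m"
          using x that by (auto simp: tuples_def)
        ultimately show ?thesis using e(2) by blast
      qed
      then show ?thesis using V x by blast
    qed
    then show ?L using e(1) by blast
  qed
  then show ?thesis
    using False by (simp add: metric_topoic_def topoic_def upoints_metric_uspace)
qed (simp add: metric_topoic_def topoic_def upoints_metric_uspace)

lemma metric_mu_ob_eq: "metric_mu_ob m = mu_ob (metric_uspace m)"
proof -
  have "metric_topoic m = topoic (metric_uspace m)" by (simp add: fun_eq_iff metric_topoic_eq)
  then show ?thesis by (simp add: metric_mu_ob_def mu_ob_def metric_uspace_def)
qed

lemma Hom_MetricSpaces:
  "Hom MetricSpaces m m' = Hom UniformSpaces (metric_uspace m) (metric_uspace m')"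
proof -
  have "uniformly_continuous_map m m' f \<longleftrightarrow>
      (\<forall>V\<in>entourages (metric_uspace m'). \<exists>U\<in>entourages (metric_uspace m). \<forall>(x, y)\<in>U. (f x, f y) \<in> V)"
    (is "?L \<longleftrightarrow> ?R")
    if f: "f \<in> mspace m \<rightarrow> mspace m'" for f
  proof
    assume uc: ?L
    show ?R
    proof
      fix V assume "V \<in> entourages (metric_uspace m')"
      then obtain e where e: "e > 0"
        "\<forall>x\<in>mspace m'. \<forall>y\<in>mspace m'. mdist m' x y < e \<longrightarrow> (x, y) \<in> V"
        by (auto simp: metric_uspace_def)
      then obtain d where d: "d > 0"
        "\<forall>x\<in>mspace m. \<forall>y\<in>mspace m. mdist m y x < d \<longrightarrow> mdist m' (f y) (f x) < e"
        using uc by (auto simp: uniformly_continuous_map_def)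
      let ?U = "{(x, y). x \<in> mspace m \<and> y \<in> mspace m \<and> mdist m x y < d}"
      have "?U \<in> entourages (metric_uspace m)"
        using d(1) by (auto simp: metric_uspace_def)
      moreover have "\<forall>(x, y)\<in>?U. (f x, f y) \<in> V"
        using d(2) e(2) f by (auto simp: Pi_iff)
      ultimately show "\<exists>U\<in>entourages (metric_uspace m). \<forall>(x, y)\<in>U. (f x, f y) \<in> V" by blast
    qed
  next
    assume uc: ?R
    have "\<exists>d>0. \<forall>x\<in>mspace m. \<forall>y\<in>mspace m. mdist m y x < d \<longrightarrow> mdist m' (f y) (f x) < e"
      if "e > 0" for e
    proof -
      let ?V = "{(x, y). x \<in> mspace m' \<and> y \<in> mspace m' \<and> mdist m' x y < e}"
      have "?V \<in> entourages (metric_uspace m')"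
        using that by (auto simp: metric_uspace_def)
      then obtain U where U: "U \<in> entourages (metric_uspace m)" "\<forall>(x, y)\<in>U. (f x, f y) \<in> ?V"
        using uc by blast
      then obtain d where "d > 0" "\<forall>x\<in>mspace m. \<forall>y\<in>mspace m. mdist m x y < d \<longrightarrow> (x, y) \<in> U"
        by (auto simp: metric_uspace_def)
      then show ?thesis using U(2) by blast
    qed
    then show ?L using f by (auto simp: uniformly_continuous_map_def)
  qed
  moreover have "f \<in> mspace m \<rightarrow> mspace m'" if "uniformly_continuous_map m m' f" for f
    using that by (auto simp: uniformly_continuous_map_def)
  ultimately show ?thesis
    unfolding MetricSpaces_def UniformSpaces_def cat.simps upoints_metric_uspace PiE_def by blast
qed

definition metric_inclusion :: "('a metric, 'a \<Rightarrow> 'a, 'a uspace, 'a \<Rightarrow> 'a) fctr" where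
  "metric_inclusion = mk_functor MetricSpaces metric_uspace (\<lambda>m m' f. f)"

text \<open>
  Together with \<open>Hom_MetricSpaces\<close>: metric spaces form a full subcategory of uniform spaces up to the
  relabelling of objects by \<open>metric_uspace\<close>. This relabelling need not be injective, since different
  metrics can induce the same uniformity.
\<close>

lemma metric_Idt_Comp:
  "Idt MetricSpaces m = Idt UniformSpaces (metric_uspace m)"
  "Comp MetricSpaces m m' m'' g f =
     Comp UniformSpaces (metric_uspace m) (metric_uspace m') (metric_uspace m'') g f"
  by (simp_all add: MetricSpaces_def UniformSpaces_def upoints_metric_uspace)

lemma metric_uspace_in_Ob: "metric_uspace m \<in> Ob UniformSpaces"
  by (simp add: UniformSpaces_def is_uspace_metric_uspace)

lemma is_category_MetricSpaces: "is_category MetricSpaces"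
  using is_category_UniformSpaces metric_uspace_in_Ob
  unfolding is_category_def Hom_MetricSpaces metric_Idt_Comp by blast

lemma is_functor_metric_inclusion: "is_functor MetricSpaces UniformSpaces metric_inclusion"
  unfolding metric_inclusion_def
  by (rule is_functor_mk_functor[OF is_category_MetricSpaces is_category_UniformSpaces])
    (simp_all add: metric_uspace_in_Ob Hom_MetricSpaces metric_Idt_Comp)

lemma fully_faithful_metric_inclusion: "fully_faithful MetricSpaces UniformSpaces metric_inclusion"
  unfolding fully_faithful_def
proof (intro ballI)
  fix m m' :: "'a metric" assume "m \<in> Ob MetricSpaces" "m' \<in> Ob MetricSpaces"
  then show "bij_betw (on_hom metric_inclusion m m') (Hom MetricSpaces m m')
      (Hom UniformSpaces (on_ob metric_inclusion m) (on_ob metric_inclusion m'))"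
    by (subst bij_betw_cong[where g = "\<lambda>f. f"])
      (auto simp: metric_inclusion_def mk_functor_apply Hom_MetricSpaces bij_betw_def)
qed

lemma metric_mu_eq: "metric_mu = comp_functor MetricSpaces mu metric_inclusion"
  unfolding metric_mu_def comp_functor_def
  by (rule mk_functor_cong)
    (simp_all add: metric_inclusion_def mu_def mk_functor_apply metric_uspace_in_Ob
      metric_mu_ob_eq Hom_MetricSpaces upoints_metric_uspace)


theorem mainTheorem4:
  shows
    "is_functor Ord_fin FinSets Forget \<and>
     (\<forall>M \<in> Ob (UniformSpaces :: ('a uspace, 'a \<Rightarrow> 'a) cat).
        is_functor (opp Ord_fin) Filt (mu_ob M) \<and>
        (\<exists>G. is_functor (opp FinSets) Filt G \<and>
             mu_ob M = comp_functor (opp Ord_fin) G (opp_functor Ord_fin Forget))) \<and>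
     is_functor (UniformSpaces :: ('a uspace, 'a \<Rightarrow> 'a) cat) (FunctorCat (opp Ord_fin) Filt) mu \<and>
     fully_faithful (UniformSpaces :: ('a uspace, 'a \<Rightarrow> 'a) cat) (FunctorCat (opp Ord_fin) Filt) mu \<and>
     (\<forall>m :: 'a metric. metric_uspace m \<in> Ob UniformSpaces \<and>
                       metric_mu_ob m = mu_ob (metric_uspace m)) \<and>
     is_functor (MetricSpaces :: ('a metric, 'a \<Rightarrow> 'a) cat) (FunctorCat (opp Ord_fin) Filt) metric_mu \<and>
     fully_faithful (MetricSpaces :: ('a metric, 'a \<Rightarrow> 'a) cat) (FunctorCat (opp Ord_fin) Filt) metric_mu"
proof -
  have "\<exists>G. is_functor (opp FinSets) Filt G \<and>
          mu_ob M = comp_functor (opp Ord_fin) G (opp_functor Ord_fin Forget)"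
    if "is_uspace M" for M :: "'a uspace"
    using is_functor_finite_powers[OF that] mu_ob_factors[OF that] by blast
  then have "\<forall>M \<in> Ob (UniformSpaces :: ('a uspace, 'a \<Rightarrow> 'a) cat).
        is_functor (opp Ord_fin) Filt (mu_ob M) \<and>
        (\<exists>G. is_functor (opp FinSets) Filt G \<and>
             mu_ob M = comp_functor (opp Ord_fin) G (opp_functor Ord_fin Forget))"
    by (simp add: UniformSpaces_def is_functor_mu_ob)
  then show ?thesis
    unfolding metric_mu_eq
    by (intro conjI allI is_functor_Forget is_functor_mu fully_faithful_mu metric_uspace_in_Ob
        metric_mu_ob_eq is_functor_comp_functor[OF is_functor_metric_inclusion]
        fully_faithful_comp_functor[OF is_functor_metric_inclusion fully_faithful_metric_inclusion])
qed

end
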